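(* Let $(X,\varphi)$, $(X_0,\varphi_0)$, $(X_1,\varphi_1)$, $(X_2,\varphi_2)$ be irreducible Smale spaces. Let $\eta_1:(X,\varphi)\to(X_1,\varphi_1)$ and $\pi_2:(X_2,\varphi_2)\to(X_0,\varphi_0)$ be s-bijective factor maps and let $\eta_2:(X,\varphi)\to(X_2,\varphi_2)$ and $\pi_1:(X_1,\varphi_1)\to(X_0,\varphi_0)$ be u-bijective factor maps, with $\pi_1\circ\eta_1=\pi_2\circ\eta_2$. Suppose that $\eta_2\times\eta_1:(X,\varphi)\to X_2\,{}_{\pi_2}\!\times_{\pi_1}X_1$, $x\mapsto(\eta_2(x),\eta_1(x))$, is onto and that, for $i=1$ or $i=2$, there exists $z\in X_i$ such that $\eta_i^{-1}\{z\}$ is a single element. Then $\eta_2\times\eta_1$ is a conjugacy.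
   Context: A Smale space $(X,\varphi)$ is a compact metric space $(X,d)$ with a homeomorphism $\varphi:X\to X$ for which there exist constants $\varepsilon_X>0$, $0<\lambda<1$ and a continuous map $(x,y)\mapsto[x,y]\in X$, defined for $d(x,y)\le\varepsilon_X$, such that $[x,x]=x$, $[x,[y,z]]=[x,z]$, $[[x,y],z]=[x,z]$, $\varphi[x,y]=[\varphi(x),\varphi(y)]$ whenever both sides are defined, $d(\varphi(y),\varphi(z))\le\lambda d(y,z)$ whenever $[y,z]=z$, and $d(\varphi^{-1}(y),\varphi^{-1}(z))\le\lambda d(y,z)$ whenever $[y,z]=y$. It is irreducible if for every ordered pair of nonempty open sets $U,V\subset X$ there is $N\ge1$ with $\varphi^N(U)\cap V\ne\varnothing$. Put $X^s(x)=\{y: \lim_{n\to+\infty}d(\varphi^n(x),\varphi^n(y))=0\}$ and $X^u(x)=\{y:\lim_{n\to+\infty}d(\varphi^{-n}(x),\varphi^{-n}(y))=0\}$. A map $\pi:(Y,\psi)\to(X,\varphi)$ is a continuous function $\pi:Y\to X$ with $\pi\circ\psi=\varphi\circ\pi$; it is a factor map if it is surjective and a conjugacy if it is a homeomorphism. It is s-bijective (respectively u-bijective) if for every $y\in Y$ the restriction $\pi|_{Y^s(y)}:Y^s(y)\to X^s(\pi(y))$ (respectively $\pi|_{Y^u(y)}:Y^u(y)\to X^u(\pi(y))$) is a bijection. For maps $\pi_i:(Y_i,\psi_i)\to(X,\varphi)$, $i=1,2$, the fibre product is $Y_1\,{}_{\pi_1}\!\times_{\pi_2}Y_2=\{(y_1,y_2)\in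 Y_1\times Y_2:\pi_1(y_1)=\pi_2(y_2)\}$ with the homeomorphism $\psi_1\times\psi_2$ and the max metric; it is a Smale space when the three given spaces are. *)

theory Defs
  imports "HOL-Analysis.Analysis"
begin

text \<open>
  A dynamical system is a carrier set in a type of class \<open>metric_space\<close>, with the metric of the
  type, together with a self-map of that carrier. Maps are total functions on the type, and only
  their values on the carrier matter.
\<close>

text \<open>
  The bracket is a total function of two points of the type, constrained only on pairs of points
  of \<open>X\<close> at distance at most \<open>\<epsilon>\<close>. Each axiom is guarded by the condition that every bracket
  occurring in it is defined.
\<close>

definition bracket_dom :: "'a::metric_space set \<Rightarrow> real \<Rightarrow> ('a \<times> 'a) set" where
  "bracket_dom X \<epsilon> = {(x, y). x \<in> X \<and> y \<in> X \<and> dist x y \<le> \<epsilon>}"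

definition smale_bracket ::
  "'a::metric_space set \<Rightarrow> ('a \<Rightarrow> 'a) \<Rightarrow> real \<Rightarrow> real \<Rightarrow> ('a \<Rightarrow> 'a \<Rightarrow> 'a) \<Rightarrow> bool" where
  "smale_bracket X \<phi> \<epsilon> \<kappa> br \<longleftrightarrow>
     continuous_on (bracket_dom X \<epsilon>) (\<lambda>(x, y). br x y) \<and>
     (\<forall>(x, y) \<in> bracket_dom X \<epsilon>. br x y \<in> X) \<and>
     (\<forall>x\<in>X. br x x = x) \<and>
     (\<forall>x\<in>X. \<forall>y\<in>X. \<forall>z\<in>X.
        dist y z \<le> \<epsilon> \<and> dist x (br y z) \<le> \<epsilon> \<and> dist x z \<le> \<epsilon> \<longrightarrow> br x (br y z) = br x z) \<and>
     (\<forall>x\<in>X. \<forall>y\<in>X. \<forall>z\<in>X.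
        dist x y \<le> \<epsilon> \<and> dist (br x y) z \<le> \<epsilon> \<and> dist x z \<le> \<epsilon> \<longrightarrow> br (br x y) z = br x z) \<and>
     (\<forall>x\<in>X. \<forall>y\<in>X.
        dist x y \<le> \<epsilon> \<and> dist (\<phi> x) (\<phi> y) \<le> \<epsilon> \<longrightarrow> \<phi> (br x y) = br (\<phi> x) (\<phi> y)) \<and>
     (\<forall>y\<in>X. \<forall>z\<in>X.
        dist y z \<le> \<epsilon> \<and> br y z = z \<longrightarrow> dist (\<phi> y) (\<phi> z) \<le> \<kappa> * dist y z) \<and>
     (\<forall>y\<in>X. \<forall>z\<in>X.
        dist y z \<le> \<epsilon> \<and> br y z = y \<longrightarrow>
        dist (inv_into X \<phi> y) (inv_into X \<phi> z) \<le> \<kappa> * dist y z)"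

definition smale_space :: "'a::metric_space set \<Rightarrow> ('a \<Rightarrow> 'a) \<Rightarrow> bool" where
  "smale_space X \<phi> \<longleftrightarrow>
     compact X \<and> (\<exists>\<psi>. homeomorphism X X \<phi> \<psi>) \<and>
     (\<exists>\<epsilon> \<kappa> br. 0 < \<epsilon> \<and> 0 < \<kappa> \<and> \<kappa> < 1 \<and> smale_bracket X \<phi> \<epsilon> \<kappa> br)"

definition irreducible_system :: "'a::metric_space set \<Rightarrow> ('a \<Rightarrow> 'a) \<Rightarrow> bool" where
  "irreducible_system X \<phi> \<longleftrightarrow>
     (\<forall>U V. openin (top_of_set X) U \<and> U \<noteq> {} \<and> openin (top_of_set X) V \<and> V \<noteq> {} \<longrightarrow>
        (\<exists>N\<ge>1. (\<phi> ^^ N) ` U \<inter> V \<noteq> {}))"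

definition stable_set :: "'a::metric_space set \<Rightarrow> ('a \<Rightarrow> 'a) \<Rightarrow> 'a \<Rightarrow> 'a set" where
  "stable_set X \<phi> x = {y \<in> X. (\<lambda>n. dist ((\<phi> ^^ n) x) ((\<phi> ^^ n) y)) \<longlonglongrightarrow> 0}"

definition unstable_set :: "'a::metric_space set \<Rightarrow> ('a \<Rightarrow> 'a) \<Rightarrow> 'a \<Rightarrow> 'a set" where
  "unstable_set X \<phi> x =
     {y \<in> X. (\<lambda>n. dist ((inv_into X \<phi> ^^ n) x) ((inv_into X \<phi> ^^ n) y)) \<longlonglongrightarrow> 0}"

text \<open>In the following predicates the arguments read \<open>\<pi> : (Y, \<psi>) \<rightarrow> (X, \<phi>)\<close>.\<close>

definition system_map ::
  "'b::metric_space set \<Rightarrow> ('b \<Rightarrow> 'b) \<Rightarrow> 'a::metric_space set \<Rightarrow> ('a \<Rightarrow> 'a) \<Rightarrow> ('b \<Rightarrow> 'a) \<Rightarrow> bool"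
  where
  "system_map Y \<psi> X \<phi> \<pi> \<longleftrightarrow>
     continuous_on Y \<pi> \<and> \<pi> ` Y \<subseteq> X \<and> (\<forall>y\<in>Y. \<pi> (\<psi> y) = \<phi> (\<pi> y))"

definition factor_map ::
  "'b::metric_space set \<Rightarrow> ('b \<Rightarrow> 'b) \<Rightarrow> 'a::metric_space set \<Rightarrow> ('a \<Rightarrow> 'a) \<Rightarrow> ('b \<Rightarrow> 'a) \<Rightarrow> bool"
  where
  "factor_map Y \<psi> X \<phi> \<pi> \<longleftrightarrow> system_map Y \<psi> X \<phi> \<pi> \<and> \<pi> ` Y = X"

definition conjugacy ::
  "'b::metric_space set \<Rightarrow> ('b \<Rightarrow> 'b) \<Rightarrow> 'a::metric_space set \<Rightarrow> ('a \<Rightarrow> 'a) \<Rightarrow> ('b \<Rightarrow> 'a) \<Rightarrow> bool"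
  where
  "conjugacy Y \<psi> X \<phi> \<pi> \<longleftrightarrow> system_map Y \<psi> X \<phi> \<pi> \<and> (\<exists>\<rho>. homeomorphism Y X \<pi> \<rho>)"

definition s_bijective ::
  "'b::metric_space set \<Rightarrow> ('b \<Rightarrow> 'b) \<Rightarrow> 'a::metric_space set \<Rightarrow> ('a \<Rightarrow> 'a) \<Rightarrow> ('b \<Rightarrow> 'a) \<Rightarrow> bool"
  where
  "s_bijective Y \<psi> X \<phi> \<pi> \<longleftrightarrow>
     (\<forall>y\<in>Y. bij_betw \<pi> (stable_set Y \<psi> y) (stable_set X \<phi> (\<pi> y)))"

definition u_bijective ::
  "'b::metric_space set \<Rightarrow> ('b \<Rightarrow> 'b) \<Rightarrow> 'a::metric_space set \<Rightarrow> ('a \<Rightarrow> 'a) \<Rightarrow> ('b \<Rightarrow> 'a) \<Rightarrow> bool"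
  where
  "u_bijective Y \<psi> X \<phi> \<pi> \<longleftrightarrow>
     (\<forall>y\<in>Y. bij_betw \<pi> (unstable_set Y \<psi> y) (unstable_set X \<phi> (\<pi> y)))"

text \<open>
  The self-map of the fibre product is \<open>map_prod \<psi>\<^sub>1 \<psi>\<^sub>2\<close>. The library metric on a product type is
  the Euclidean combination of the two metrics rather than their maximum; the two induce the same
  topology (lemma \<open>open_prod_max_dist\<close>), and the notions of map, factor map and conjugacy
  depend only on the topology.
\<close>

definition fibre_product ::
  "'b set \<Rightarrow> ('b \<Rightarrow> 'a) \<Rightarrow> 'c set \<Rightarrow> ('c \<Rightarrow> 'a) \<Rightarrow> ('b \<times> 'c) set" where
  "fibre_product Y1 \<pi>1 Y2 \<pi>2 = {(y1, y2). y1 \<in> Y1 \<and> y2 \<in> Y2 \<and> \<pi>1 y1 = \<pi>2 y2}"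

lemma open_prod_max_dist:
  fixes S :: "('b::metric_space \<times> 'c::metric_space) set"
  shows "open S \<longleftrightarrow>
    (\<forall>p\<in>S. \<exists>e>0. \<forall>q. max (dist (fst p) (fst q)) (dist (snd p) (snd q)) < e \<longrightarrow> q \<in> S)"
proof
  assume S: "open S"
  show "\<forall>p\<in>S. \<exists>e>0. \<forall>q. max (dist (fst p) (fst q)) (dist (snd p) (snd q)) < e \<longrightarrow> q \<in> S"
  proof
    fix p assume "p \<in> S"
    then obtain e where e: "e > 0" "\<And>q. dist q p < e \<Longrightarrow> q \<in> S"
      using S unfolding open_dist by blast
    have "q \<in> S" if "max (dist (fst p) (fst q)) (dist (snd p) (snd q)) < e / 2" for q
    proof -
      have "dist q p \<le> dist (fst q) (fst p) + dist (snd q) (snd p)"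
        unfolding dist_prod_def by (rule sqrt_sum_squares_le_sum) simp_all
      with that have "dist q p < e" by (simp add: dist_commute)
      then show ?thesis by (rule e(2))
    qed
    with e(1) show "\<exists>e>0. \<forall>q. max (dist (fst p) (fst q)) (dist (snd p) (snd q)) < e \<longrightarrow> q \<in> S"
      by (intro exI[of _ "e / 2"]) auto
  qed
next
  assume R: "\<forall>p\<in>S. \<exists>e>0. \<forall>q. max (dist (fst p) (fst q)) (dist (snd p) (snd q)) < e \<longrightarrow> q \<in> S"
  show "open S"
    unfolding open_dist
  proof
    fix p assume "p \<in> S"
    with R obtain e where e: "e > 0"
      "\<And>q. max (dist (fst p) (fst q)) (dist (snd p) (snd q)) < e \<Longrightarrow> q \<in> S" by blast
    have "q \<in> S" if "dist q p < e" for q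
      using that dist_fst_le[of p q] dist_snd_le[of p q]
      by (intro e(2)) (simp add: dist_commute)
    with e(1) show "\<exists>e>0. \<forall>q. dist q p < e \<longrightarrow> q \<in> S" by blast
  qed
qed

end

theory Submission
  imports Defs
begin

text \<open>
  Write \<open>\<rho> = \<eta>2 \<times> \<eta>1\<close>. By compactness \<open>\<rho>\<close> is a conjugacy as soon as it is injective, so consider
  the set \<open>B\<close> of points that share their image under \<open>\<rho>\<close> with another point. The heart of the proof
  is that \<open>B\<close> is a union of stable classes and also a union of unstable classes
  (lemma \<open>double_points_stable_saturated\<close>): a twin \<open>x'\<close> of \<open>x\<close> can be transported along the stable
  class of \<open>x\<close>, because \<open>\<eta>1\<close> lifts stable classes and \<open>\<pi>2\<close> is injective on them. Reversing time and
  exchanging the indices gives the unstable version.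

  In a Smale space any two sufficiently close points \<open>x\<close>, \<open>a\<close> are joined by a stable step from \<open>x\<close> to
  the bracket \<open>[x, a]\<close> and an unstable step from there to \<open>a\<close> (lemma \<open>stable_unstable_connection\<close>).
  Hence \<open>B\<close> contains a ball of a fixed radius around each of its points, and so does its complement:
  both are open. As \<open>B\<close> is forward invariant and its complement contains the point with a singleton
  fibre, irreducibility of \<open>(X, \<phi>)\<close> forces \<open>B\<close> to be empty.

  Behind this is the fact that \<open>\<rho>\<close> is both s-bijective and u-bijective, and that a map of this kind
  out of an irreducible Smale space has fibres of constant cardinality; only the distinction between
  one and several points in a fibre matters here.
\<close>

section \<open>Stable equivalence\<close>

lemma stable_set_sym:
  assumes "x \<in> X" "y \<in> stable_set X \<phi> x"
  shows "x \<in> stable_set X \<phi> y"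
  using assms by (simp add: stable_set_def dist_commute)

text \<open>
  Time reversal: with this identity and \<open>system_map_inv_into\<close>, facts about stable sets of the
  inverse systems become facts about unstable sets.
\<close>

lemma unstable_set_eq_stable_set_inv_into:
  "unstable_set X \<phi> = stable_set X (inv_into X \<phi>)"
  by (simp add: fun_eq_iff unstable_set_def stable_set_def)

lemma funpow_mem:
  assumes "\<phi> ` X \<subseteq> X" "x \<in> X"
  shows "(\<phi> ^^ n) x \<in> X"
  using assms by (induction n) auto

lemma system_map_funpow:
  assumes "system_map Y \<psi> X \<phi> \<pi>" "\<psi> ` Y \<subseteq> Y" "y \<in> Y"
  shows "\<pi> ((\<psi> ^^ n) y) = (\<phi> ^^ n) (\<pi> y)"
  using assms funpow_mem[OF assms(2,3)] by (induction n) (auto simp: system_map_def)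

lemma system_map_inv_into:
  assumes \<pi>: "system_map Y \<psi> X \<phi> \<pi>" and \<psi>: "bij_betw \<psi> Y Y" and \<phi>: "bij_betw \<phi> X X"
  shows "system_map Y (inv_into Y \<psi>) X (inv_into X \<phi>) \<pi>"
proof -
  have "\<pi> (inv_into Y \<psi> y) = inv_into X \<phi> (\<pi> y)" if y: "y \<in> Y" for y
  proof -
    have Y: "inv_into Y \<psi> y \<in> Y"
      using bij_betw_inv_into[OF \<psi>] y by (rule bij_betwE[THEN bspec])
    then have "\<phi> (\<pi> (inv_into Y \<psi> y)) = \<pi> y"
      using \<pi> bij_betw_inv_into_right[OF \<psi> y] by (metis system_map_def)
    moreover have "\<pi> (inv_into Y \<psi> y) \<in> X"
      using \<pi> Y by (auto simp: system_map_def)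
    ultimately show ?thesis
      using bij_betw_inv_into_left[OF \<phi>] by metis
  qed
  then show ?thesis
    using \<pi> by (simp add: system_map_def)
qed

text \<open>Compactness turns continuity into uniform continuity, which preserves asymptotic orbits.\<close>

lemma system_map_stable_set:
  assumes \<pi>: "system_map Y \<psi> X \<phi> \<pi>" and "compact Y" and \<psi>: "\<psi> ` Y \<subseteq> Y"
    and y: "y \<in> Y" and z: "z \<in> stable_set Y \<psi> y"
  shows "\<pi> z \<in> stable_set X \<phi> (\<pi> y)"
proof -
  have zY: "z \<in> Y" and lim: "(\<lambda>n. dist ((\<psi> ^^ n) y) ((\<psi> ^^ n) z)) \<longlonglongrightarrow> 0"
    using z by (auto simp: stable_set_def)
  have "uniformly_continuous_on Y \<pi>"
    using \<pi> \<open>compact Y\<close> by (simp add: system_map_def compact_uniformly_continuous)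
  then have "(\<lambda>n. dist (\<pi> ((\<psi> ^^ n) y)) (\<pi> ((\<psi> ^^ n) z))) \<longlonglongrightarrow> 0"
    unfolding uniformly_continuous_on_sequentially
    using funpow_mem[OF \<psi> y] funpow_mem[OF \<psi> zY] lim by (elim allE impE) auto
  then show ?thesis
    using \<pi> zY by (auto simp: stable_set_def system_map_funpow[OF \<pi> \<psi>] y system_map_def)
qed

section \<open>Points that share both images with another point\<close>

definition double_points :: "'a set \<Rightarrow> ('a \<Rightarrow> 'c) \<Rightarrow> ('a \<Rightarrow> 'd) \<Rightarrow> 'a set" where
  "double_points X \<eta>1 \<eta>2 = {x \<in> X. \<exists>x'\<in>X. x' \<noteq> x \<and> \<eta>1 x' = \<eta>1 x \<and> \<eta>2 x' = \<eta>2 x}"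

lemma double_points_commute: "double_points X \<eta>1 \<eta>2 = double_points X \<eta>2 \<eta>1"
  by (auto simp: double_points_def)

lemma double_points_neq_if_singleton_fibre:
  assumes "is_singleton {x \<in> X. \<eta>1 x = z}"
  shows "double_points X \<eta>1 \<eta>2 \<noteq> X"
proof -
  obtain y where fibre: "{x \<in> X. \<eta>1 x = z} = {y}"
    using assms by (rule is_singletonE)
  have "y \<in> {x \<in> X. \<eta>1 x = z}"
    unfolding fibre by simp
  then have y: "y \<in> X" "\<eta>1 y = z"
    by simp_all
  have "x = y" if "x \<in> X" "\<eta>1 x = \<eta>1 y" for x
  proof -
    have "x \<in> {x \<in> X. \<eta>1 x = z}"
      using that y by simp
    then show ?thesis
      unfolding fibre by simp
  qed
  then have "y \<notin> double_points X \<eta>1 \<eta>2"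
    unfolding double_points_def by blast
  with y(1) show ?thesis
    by metis
qed

lemma double_points_forward:
  assumes "system_map X \<phi> X1 \<phi>1 \<eta>1" "system_map X \<phi> X2 \<phi>2 \<eta>2" "bij_betw \<phi> X X"
    and x: "x \<in> double_points X \<eta>1 \<eta>2"
  shows "\<phi> x \<in> double_points X \<eta>1 \<eta>2"
proof -
  obtain x' where x': "x \<in> X" "x' \<in> X" "x' \<noteq> x" "\<eta>1 x' = \<eta>1 x" "\<eta>2 x' = \<eta>2 x"
    using x by (auto simp: double_points_def)
  then have "\<phi> x' \<noteq> \<phi> x" "\<phi> x \<in> X" "\<phi> x' \<in> X"
    using assms(3) by (auto simp: bij_betw_def inj_on_def)
  then show ?thesis
    using x' assms(1,2) by (auto simp: double_points_def system_map_def intro!: bexI[of _ "\<phi> x'"])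
qed

text \<open>
  The twin \<open>x'\<close> of \<open>x\<close> is carried to a twin of \<open>w\<close> by lifting \<open>\<eta>1 w\<close> through \<open>\<eta>1\<close> to the stable class
  of \<open>x'\<close>. The lift agrees with \<open>w\<close> under \<open>\<eta>2\<close> because \<open>\<pi>2\<close> is injective on stable classes, and it
  differs from \<open>w\<close> because otherwise \<open>x\<close> and \<open>x'\<close> would be stably equivalent with the same
  image under \<open>\<eta>1\<close>.
\<close>

lemma double_points_stable_saturated:
  assumes "compact X" "bij_betw \<phi> X X"
    and \<eta>1: "system_map X \<phi> X1 \<phi>1 \<eta>1" "s_bijective X \<phi> X1 \<phi>1 \<eta>1"
    and \<eta>2: "system_map X \<phi> X2 \<phi>2 \<eta>2"
    and \<pi>2: "s_bijective X2 \<phi>2 X0 \<phi>0 \<pi>2"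
    and commutes: "\<And>x. x \<in> X \<Longrightarrow> \<pi>1 (\<eta>1 x) = \<pi>2 (\<eta>2 x)"
    and x: "x \<in> double_points X \<eta>1 \<eta>2" and w: "w \<in> stable_set X \<phi> x"
  shows "w \<in> double_points X \<eta>1 \<eta>2"
proof -
  have \<phi>: "\<phi> ` X \<subseteq> X"
    using assms(2) by (simp add: bij_betw_def)
  obtain x' where x': "x \<in> X" "x' \<in> X" "x' \<noteq> x" "\<eta>1 x' = \<eta>1 x" "\<eta>2 x' = \<eta>2 x"
    using x by (auto simp: double_points_def)
  have wX: "w \<in> X"
    using w by (simp add: stable_set_def)
  have "\<eta>1 w \<in> stable_set X1 \<phi>1 (\<eta>1 x')"
    using system_map_stable_set[OF \<eta>1(1) \<open>compact X\<close> \<phi> \<open>x \<in> X\<close> w] x'(4) by simp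
  moreover have "\<eta>1 ` stable_set X \<phi> x' = stable_set X1 \<phi>1 (\<eta>1 x')"
    using \<eta>1(2) x'(2) by (simp add: s_bijective_def bij_betw_def)
  ultimately obtain w' where w': "w' \<in> stable_set X \<phi> x'" "\<eta>1 w' = \<eta>1 w"
    by (metis imageE)
  have w'X: "w' \<in> X"
    using w'(1) by (simp add: stable_set_def)
  have "\<eta>2 w' = \<eta>2 w"
  proof (rule inj_onD)
    show "inj_on \<pi>2 (stable_set X2 \<phi>2 (\<eta>2 x))"
      using \<pi>2 \<eta>2 x'(1) by (auto simp: s_bijective_def bij_betw_def system_map_def)
    show "\<pi>2 (\<eta>2 w') = \<pi>2 (\<eta>2 w)"
      using commutes wX w'X w'(2) by metis
    show "\<eta>2 w \<in> stable_set X2 \<phi>2 (\<eta>2 x)" "\<eta>2 w' \<in> stable_set X2 \<phi>2 (\<eta>2 x)"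
      using system_map_stable_set[OF \<eta>2 \<open>compact X\<close> \<phi> \<open>x \<in> X\<close> w]
        system_map_stable_set[OF \<eta>2 \<open>compact X\<close> \<phi> \<open>x' \<in> X\<close> w'(1)] x'(5) by simp_all
  qed
  moreover have "w' \<noteq> w"
  proof
    assume "w' = w"
    then have "x \<in> stable_set X \<phi> w" "x' \<in> stable_set X \<phi> w"
      using stable_set_sym w w'(1) x'(1,2) by metis+
    moreover have "inj_on \<eta>1 (stable_set X \<phi> w)"
      using \<eta>1(2) wX by (simp add: s_bijective_def bij_betw_def)
    ultimately show False
      using x'(3,4) by (metis inj_onD)
  qed
  ultimately show ?thesis
    using wX w'X w'(2) by (auto simp: double_points_def)
qed

section \<open>Local product structure of a Smale space\<close>

lemma smale_space_bij_betw:
  assumes "smale_space X \<phi>"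
  shows "bij_betw \<phi> X X"
proof -
  obtain \<psi> where "homeomorphism X X \<phi> \<psi>"
    using assms unfolding smale_space_def by blast
  then show ?thesis
    unfolding homeomorphism_def bij_betw_def by (metis inj_on_inverseI)
qed

text \<open>
  The contraction axioms of a Smale space hold only for nearby points in a bracket relation, so they
  can be iterated only if this restriction survives each step. It does, because contraction keeps
  the points close and the bracket commutes with the dynamics; \<open>P\<close> stands for the restriction.
\<close>

lemma stable_set_if_contracting:
  assumes \<kappa>: "0 < \<kappa>" "\<kappa> < 1" and f: "f ` X \<subseteq> X"
    and step: "\<And>y z. y \<in> X \<Longrightarrow> z \<in> X \<Longrightarrow> P y z \<Longrightarrow>
      dist (f y) (f z) \<le> \<kappa> * dist y z \<and> P (f y) (f z)"
    and x: "x \<in> X" and w: "w \<in> X" and P: "P x w"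
  shows "w \<in> stable_set X f x"
proof -
  have *: "dist ((f ^^ n) x) ((f ^^ n) w) \<le> \<kappa> ^ n * dist x w \<and> P ((f ^^ n) x) ((f ^^ n) w)" for n
  proof (induction n)
    case 0
    then show ?case using P by simp
  next
    case (Suc n)
    then have "dist ((f ^^ Suc n) x) ((f ^^ Suc n) w) \<le> \<kappa> * dist ((f ^^ n) x) ((f ^^ n) w)"
      and "P ((f ^^ Suc n) x) ((f ^^ Suc n) w)"
      using step[OF funpow_mem[OF f x] funpow_mem[OF f w]] by auto
    moreover have "\<kappa> * dist ((f ^^ n) x) ((f ^^ n) w) \<le> \<kappa> ^ Suc n * dist x w"
      using Suc \<kappa> by (simp add: mult.assoc mult_left_mono)
    ultimately show ?case by auto
  qed
  have "(\<lambda>n. \<kappa> ^ n * dist x w) \<longlonglongrightarrow> 0"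
    using \<kappa> by (intro tendsto_mult_left_zero LIMSEQ_power_zero) simp
  then have "(\<lambda>n. dist ((f ^^ n) x) ((f ^^ n) w)) \<longlonglongrightarrow> 0"
    by (rule Lim_null_comparison[rotated]) (use * in simp)
  then show ?thesis
    using w by (simp add: stable_set_def)
qed

lemma smale_bracketD:
  assumes "smale_bracket X \<phi> \<epsilon> \<kappa> br" "x \<in> X" "y \<in> X" "dist x y \<le> \<epsilon>"
  shows "br x y \<in> X"
    and "dist x (br x y) \<le> \<epsilon> \<Longrightarrow> br x (br x y) = br x y"
    and "dist (br x y) y \<le> \<epsilon> \<Longrightarrow> br (br x y) y = br x y"
    and "dist (\<phi> x) (\<phi> y) \<le> \<epsilon> \<Longrightarrow> \<phi> (br x y) = br (\<phi> x) (\<phi> y)"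
    and "br x y = y \<Longrightarrow> dist (\<phi> x) (\<phi> y) \<le> \<kappa> * dist x y"
    and "br x y = x \<Longrightarrow> dist (inv_into X \<phi> x) (inv_into X \<phi> y) \<le> \<kappa> * dist x y"
  using assms unfolding smale_bracket_def bracket_dom_def by blast+

lemma smale_bracket_eq_right_imp_stable:
  assumes br: "smale_bracket X \<phi> \<epsilon> \<kappa> br" and \<kappa>: "0 < \<kappa>" "\<kappa> < 1" and \<phi>: "bij_betw \<phi> X X"
    and "x \<in> X" "w \<in> X" "dist x w \<le> \<epsilon>" "br x w = w"
  shows "w \<in> stable_set X \<phi> x"
proof (rule stable_set_if_contracting[where P = "\<lambda>y z. dist y z \<le> \<epsilon> \<and> br y z = z"])
  show "\<phi> ` X \<subseteq> X"
    using \<phi> by (simp add: bij_betw_def)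
next
  fix y z assume yz: "y \<in> X" "z \<in> X" "dist y z \<le> \<epsilon> \<and> br y z = z"
  then have contr: "dist (\<phi> y) (\<phi> z) \<le> \<kappa> * dist y z"
    using smale_bracketD(5)[OF br] by blast
  then have "dist (\<phi> y) (\<phi> z) \<le> \<epsilon>"
    using yz \<kappa> mult_left_le_one_le[of "dist y z" \<kappa>] by simp
  moreover from this have "br (\<phi> y) (\<phi> z) = \<phi> (br y z)"
    using smale_bracketD(4)[OF br] yz by metis
  ultimately show "dist (\<phi> y) (\<phi> z) \<le> \<kappa> * dist y z \<and> dist (\<phi> y) (\<phi> z) \<le> \<epsilon> \<and> br (\<phi> y) (\<phi> z) = \<phi> z"
    using contr yz by simp
qed (use assms in auto)

lemma smale_bracket_eq_left_imp_unstable: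
  assumes br: "smale_bracket X \<phi> \<epsilon> \<kappa> br" and \<kappa>: "0 < \<kappa>" "\<kappa> < 1" and \<phi>: "bij_betw \<phi> X X"
    and "x \<in> X" "w \<in> X" "dist x w \<le> \<epsilon>" "br x w = x"
  shows "w \<in> unstable_set X \<phi> x"
  unfolding unstable_set_eq_stable_set_inv_into
proof (rule stable_set_if_contracting[where P = "\<lambda>y z. dist y z \<le> \<epsilon> \<and> br y z = y"])
  show "inv_into X \<phi> ` X \<subseteq> X"
    using bij_betw_inv_into[OF \<phi>] by (simp add: bij_betw_def)
next
  fix y z assume yz: "y \<in> X" "z \<in> X" "dist y z \<le> \<epsilon> \<and> br y z = y"
  let ?y = "inv_into X \<phi> y" and ?z = "inv_into X \<phi> z"
  have X: "?y \<in> X" "?z \<in> X"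
    using bij_betw_inv_into[OF \<phi>] yz by (auto simp: bij_betw_def)
  have \<phi>_inv: "\<phi> ?y = y" "\<phi> ?z = z"
    using bij_betw_inv_into_right[OF \<phi>] yz by auto
  have contr: "dist ?y ?z \<le> \<kappa> * dist y z"
    using smale_bracketD(6)[OF br] yz by blast
  then have le: "dist ?y ?z \<le> \<epsilon>"
    using yz \<kappa> mult_left_le_one_le[of "dist y z" \<kappa>] by simp
  then have "\<phi> (br ?y ?z) = br (\<phi> ?y) (\<phi> ?z)"
    using smale_bracketD(4)[OF br X] yz \<phi>_inv by simp
  then have "\<phi> (br ?y ?z) = \<phi> ?y"
    using yz \<phi>_inv by simp
  moreover have "br ?y ?z \<in> X"
    using smale_bracketD(1)[OF br X] le by blast
  ultimately have "br ?y ?z = ?y"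
    using \<phi> X by (auto simp: bij_betw_def dest: inj_onD)
  then show "dist ?y ?z \<le> \<kappa> * dist y z \<and> dist ?y ?z \<le> \<epsilon> \<and> br ?y ?z = ?y"
    using contr le by simp
qed (use assms in auto)

lemma compact_bracket_dom:
  assumes "compact X"
  shows "compact (bracket_dom X \<epsilon>)"
proof -
  have "bracket_dom X \<epsilon> = (X \<times> X) \<inter> {p. dist (fst p) (snd p) \<le> \<epsilon>}"
    by (auto simp: bracket_dom_def)
  moreover have "closed {p :: 'a \<times> 'a. dist (fst p) (snd p) \<le> \<epsilon>}"
    by (intro closed_Collect_le continuous_intros)
  ultimately show ?thesis
    using assms by (simp add: compact_Int_closed compact_Times)
qed

text \<open>
  The bracket \<open>[x, a]\<close> is the intermediate point. It is fixed by bracketing with \<open>x\<close> on the left and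
  with \<open>a\<close> on the right, so the contraction axioms apply to it once it is close to both; since
  \<open>[x, x] = x\<close>, uniform continuity of the bracket ensures this uniformly for \<open>a\<close> close to \<open>x\<close>.
\<close>

lemma stable_unstable_connection:
  assumes "smale_space X \<phi>"
  obtains \<delta> where "\<delta> > 0"
    and "\<And>x a. x \<in> X \<Longrightarrow> a \<in> X \<Longrightarrow> dist x a < \<delta> \<Longrightarrow>
      \<exists>w. w \<in> stable_set X \<phi> x \<and> a \<in> unstable_set X \<phi> w"
proof -
  obtain \<epsilon> \<kappa> br where \<epsilon>: "0 < \<epsilon>" and \<kappa>: "0 < \<kappa>" "\<kappa> < 1" and br: "smale_bracket X \<phi> \<epsilon> \<kappa> br"
    using assms unfolding smale_space_def by blast
  note \<phi> = smale_space_bij_betw[OF assms]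
  have "compact X"
    using assms by (simp add: smale_space_def)
  have "uniformly_continuous_on (bracket_dom X \<epsilon>) (\<lambda>(x, y). br x y)"
    using br[unfolded smale_bracket_def, THEN conjunct1] compact_bracket_dom[OF \<open>compact X\<close>]
    by (rule compact_uniformly_continuous)
  from this[unfolded uniformly_continuous_on_def, rule_format, of "\<epsilon> / 2"] \<epsilon>
  obtain d where d: "d > 0" and close:
    "\<forall>p\<in>bracket_dom X \<epsilon>. \<forall>q\<in>bracket_dom X \<epsilon>. dist q p < d \<longrightarrow>
      dist (case_prod br q) (case_prod br p) < \<epsilon> / 2"
    by auto
  \<comment> \<open>Half of \<open>\<epsilon>\<close> bounds the distance from \<open>x\<close> to \<open>[x, a]\<close>, the other half that from \<open>x\<close> to \<open>a\<close>, so
    that \<open>[x, a]\<close> and \<open>a\<close> are within \<open>\<epsilon>\<close> as well.\<close>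
  have "\<exists>w. w \<in> stable_set X \<phi> x \<and> a \<in> unstable_set X \<phi> w"
    if x: "x \<in> X" and a: "a \<in> X" and xa: "dist x a < min d (\<epsilon> / 2)" for x a
  proof -
    have le: "dist x a \<le> \<epsilon>"
      using xa \<epsilon> by simp
    have brX: "br x a \<in> X"
      using smale_bracketD(1)[OF br x a le] .
    have xx: "br x x = x"
      using br[unfolded smale_bracket_def, THEN conjunct2, THEN conjunct2, THEN conjunct1] x
      by (rule bspec)
    have "dist (case_prod br (x, x)) (case_prod br (x, a)) < \<epsilon> / 2"
      using x a le xa \<epsilon> by (intro close[rule_format]) (auto simp: bracket_dom_def dist_prod_def)
    then have near_x: "dist x (br x a) < \<epsilon> / 2"
      using xx by simp
    have near_a: "dist (br x a) a \<le> \<epsilon>"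
      using near_x xa dist_triangle[of "br x a" a x] by (simp add: dist_commute)
    have "br x (br x a) = br x a"
      using smale_bracketD(2)[OF br x a le] near_x \<epsilon> by simp
    then have "br x a \<in> stable_set X \<phi> x"
      using smale_bracket_eq_right_imp_stable[OF br \<kappa> \<phi> x brX] near_x \<epsilon> by simp
    moreover have "br (br x a) a = br x a"
      using smale_bracketD(3)[OF br x a le] near_a by blast
    then have "a \<in> unstable_set X \<phi> (br x a)"
      using smale_bracket_eq_left_imp_unstable[OF br \<kappa> \<phi> brX a] near_a by simp
    ultimately show ?thesis by blast
  qed
  moreover have "min d (\<epsilon> / 2) > 0"
    using d \<epsilon> by simp
  ultimately show thesis
    using that by blast
qed

text \<open>
  The radius at which stable and unstable steps connect points is uniform, so a saturated set is
  both open and closed. Irreducibility would carry some point of a nonempty invariant such set into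
  its complement, were the complement nonempty.
\<close>

lemma invariant_saturated_set_trivial:
  assumes X: "smale_space X \<phi>" and irr: "irreducible_system X \<phi>"
    and B: "B \<subseteq> X" and forward: "\<And>x. x \<in> B \<Longrightarrow> \<phi> x \<in> B"
    and stable: "\<And>x w. x \<in> B \<Longrightarrow> w \<in> stable_set X \<phi> x \<Longrightarrow> w \<in> B"
    and unstable: "\<And>x w. x \<in> B \<Longrightarrow> w \<in> unstable_set X \<phi> x \<Longrightarrow> w \<in> B"
    and proper: "B \<noteq> X"
  shows "B = {}"
proof (rule ccontr)
  assume "B \<noteq> {}"
  obtain \<delta> where \<delta>: "\<delta> > 0" "\<And>x a. x \<in> X \<Longrightarrow> a \<in> X \<Longrightarrow> dist x a < \<delta> \<Longrightarrow>
      \<exists>w. w \<in> stable_set X \<phi> x \<and> a \<in> unstable_set X \<phi> w"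
    using stable_unstable_connection[OF X] by blast
  have near: "a \<in> B" if "x \<in> B" "a \<in> X" "dist x a < \<delta>" for x a
    using that \<delta>(2) B stable unstable by blast
  have "openin (top_of_set X) B"
    unfolding openin_euclidean_subtopology_iff
    using B near \<delta>(1) by (metis dist_commute)
  moreover have "openin (top_of_set X) (X - B)"
    unfolding openin_euclidean_subtopology_iff
    using near \<delta>(1) by (metis DiffD1 DiffD2 DiffI Diff_subset)
  ultimately obtain N where "(\<phi> ^^ N) ` B \<inter> (X - B) \<noteq> {}"
    using irr \<open>B \<noteq> {}\<close> B proper unfolding irreducible_system_def
    by (metis Diff_eq_empty_iff subset_antisym)
  moreover have "(\<phi> ^^ N) ` B \<subseteq> B"
    using funpow_mem[of \<phi> B] forward by blast
  ultimately show False by blast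
qed

section \<open>The conjugacy\<close>

theorem theorem3p5:
  fixes X :: "'a::metric_space set" and \<phi> :: "'a \<Rightarrow> 'a"
    and X0 :: "'b::metric_space set" and \<phi>0 :: "'b \<Rightarrow> 'b"
    and X1 :: "'c::metric_space set" and \<phi>1 :: "'c \<Rightarrow> 'c"
    and X2 :: "'d::metric_space set" and \<phi>2 :: "'d \<Rightarrow> 'd"
    and \<eta>1 :: "'a \<Rightarrow> 'c" and \<eta>2 :: "'a \<Rightarrow> 'd"
    and \<pi>1 :: "'c \<Rightarrow> 'b" and \<pi>2 :: "'d \<Rightarrow> 'b"
  assumes "smale_space X \<phi>" and "irreducible_system X \<phi>"
    and "smale_space X0 \<phi>0" and "irreducible_system X0 \<phi>0"
    and "smale_space X1 \<phi>1" and "irreducible_system X1 \<phi>1"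
    and "smale_space X2 \<phi>2" and "irreducible_system X2 \<phi>2"
    and "factor_map X \<phi> X1 \<phi>1 \<eta>1" and "s_bijective X \<phi> X1 \<phi>1 \<eta>1"
    and "factor_map X2 \<phi>2 X0 \<phi>0 \<pi>2" and "s_bijective X2 \<phi>2 X0 \<phi>0 \<pi>2"
    and "factor_map X \<phi> X2 \<phi>2 \<eta>2" and "u_bijective X \<phi> X2 \<phi>2 \<eta>2"
    and "factor_map X1 \<phi>1 X0 \<phi>0 \<pi>1" and "u_bijective X1 \<phi>1 X0 \<phi>0 \<pi>1"
    and "\<forall>x\<in>X. \<pi>1 (\<eta>1 x) = \<pi>2 (\<eta>2 x)"
    and "(\<lambda>x. (\<eta>2 x, \<eta>1 x)) ` X = fibre_product X2 \<pi>2 X1 \<pi>1"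
    and "(\<exists>z\<in>X1. is_singleton {x \<in> X. \<eta>1 x = z}) \<or> (\<exists>z\<in>X2. is_singleton {x \<in> X. \<eta>2 x = z})"
  shows "conjugacy X \<phi> (fibre_product X2 \<pi>2 X1 \<pi>1) (map_prod \<phi>2 \<phi>1) (\<lambda>x. (\<eta>2 x, \<eta>1 x))"
proof -
  let ?B = "double_points X \<eta>1 \<eta>2" and ?\<rho> = "\<lambda>x. (\<eta>2 x, \<eta>1 x)"
  have "compact X"
    using assms(1) by (simp add: smale_space_def)
  note bij = smale_space_bij_betw[OF assms(1)]
  note bij1 = smale_space_bij_betw[OF assms(5)] and bij2 = smale_space_bij_betw[OF assms(7)]
  have \<eta>1: "system_map X \<phi> X1 \<phi>1 \<eta>1" and \<eta>2: "system_map X \<phi> X2 \<phi>2 \<eta>2"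
    using assms(9,13) by (simp_all add: factor_map_def)
  have commutes: "\<pi>1 (\<eta>1 x) = \<pi>2 (\<eta>2 x)" if "x \<in> X" for x
    using assms(17) that by blast
  have "?B = {}"
  proof (rule invariant_saturated_set_trivial[OF assms(1,2)])
    show "?B \<subseteq> X"
      by (auto simp: double_points_def)
    show "?B \<noteq> X"
      using assms(19)
    proof
      assume "\<exists>z\<in>X1. is_singleton {x \<in> X. \<eta>1 x = z}"
      then obtain z where "is_singleton {x \<in> X. \<eta>1 x = z}"
        by (elim bexE)
      then show ?thesis
        by (rule double_points_neq_if_singleton_fibre)
    next
      assume "\<exists>z\<in>X2. is_singleton {x \<in> X. \<eta>2 x = z}"
      then obtain z where "is_singleton {x \<in> X. \<eta>2 x = z}"
        by (elim bexE)
      then show ?thesis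
        unfolding double_points_commute[of X \<eta>1] by (rule double_points_neq_if_singleton_fibre)
    qed
  next
    fix x assume x: "x \<in> ?B"
    show "\<phi> x \<in> ?B"
      using double_points_forward[OF \<eta>1 \<eta>2 bij x] .
    fix w
    show "w \<in> ?B" if "w \<in> stable_set X \<phi> x"
      using double_points_stable_saturated[OF \<open>compact X\<close> bij \<eta>1 assms(10) \<eta>2 assms(12)
          commutes x that] .
    show "w \<in> ?B" if w: "w \<in> unstable_set X \<phi> x"
    proof -
      \<comment> \<open>The stable case for the inverse systems, in which the indices 1 and 2 change roles.\<close>
      have "w \<in> double_points X \<eta>2 \<eta>1"
      proof (rule double_points_stable_saturated)
        show "bij_betw (inv_into X \<phi>) X X"
          using bij by (rule bij_betw_inv_into)
        show "system_map X (inv_into X \<phi>) X2 (inv_into X2 \<phi>2) \<eta>2"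
          using \<eta>2 bij bij2 by (rule system_map_inv_into)
        show "system_map X (inv_into X \<phi>) X1 (inv_into X1 \<phi>1) \<eta>1"
          using \<eta>1 bij bij1 by (rule system_map_inv_into)
        show "s_bijective X (inv_into X \<phi>) X2 (inv_into X2 \<phi>2) \<eta>2"
          "s_bijective X1 (inv_into X1 \<phi>1) X0 (inv_into X0 \<phi>0) \<pi>1"
          using assms(14,16)
          by (simp_all add: s_bijective_def u_bijective_def unstable_set_eq_stable_set_inv_into)
        show "w \<in> stable_set X (inv_into X \<phi>) x"
          using w by (simp add: unstable_set_eq_stable_set_inv_into)
        show "x \<in> double_points X \<eta>2 \<eta>1"
          using x unfolding double_points_commute[of X \<eta>1] .
        show "\<pi>2 (\<eta>2 y) = \<pi>1 (\<eta>1 y)" if "y \<in> X" for y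
          using commutes[OF that] by (rule sym)
      qed (fact \<open>compact X\<close>)
      then show ?thesis
        unfolding double_points_commute[of X \<eta>1] .
    qed
  qed
  then have inj: "inj_on ?\<rho> X"
    by (auto simp: double_points_def inj_on_def)
  have cont: "continuous_on X ?\<rho>"
    using \<eta>1 \<eta>2 by (auto simp: system_map_def intro: continuous_on_Pair)
  have "\<exists>\<sigma>. homeomorphism X (fibre_product X2 \<pi>2 X1 \<pi>1) ?\<rho> \<sigma>"
    using homeomorphism_compact[OF \<open>compact X\<close> cont assms(18) inj] by metis
  moreover have "system_map X \<phi> (fibre_product X2 \<pi>2 X1 \<pi>1) (map_prod \<phi>2 \<phi>1) ?\<rho>"
    using cont assms(18) \<eta>1 \<eta>2 by (auto simp: system_map_def)
  ultimately show ?thesis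
    by (simp add: conjugacy_def)
qed

end
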